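(* Let $N>1$ be an integer. For every $m\ge1$, the values $1$ and $N$ are Dirichlet eigenvalues of $H_m$, with multiplicities given by $M_m(1)=N$ and $M_m(N)=N^m(N-2)$.
   Context: Let $S=\{1,\dots,N\}$ and $\Sigma_N^+=S^{\mathbb{N}}$. For $m\ge 0$, $V_m\subset\Sigma_N^+$ is the set of sequences constant from position $m+1$ on; its elements are written $(p_1\cdots p_m\dot p_{m+1})=(p_1\cdots p_m p_{m+1}p_{m+1}\cdots)$. Thus $V_0\subset V_1\subset\cdots$ and $\#V_m=N^{m+1}$. For $p\in V_m$, $\mathcal{U}_{p,m}=\{(p_1\cdots p_m\dot l):l\in S\}\setminus\{p\}$ ($N-1$ points). $\ell(V_m)$ is the space of real functions on $V_m$. The difference operators $H_m:\ell(V_m)\to\ell(V_m)$ are given by $H_0u(p)=-(N-1)u(p)+\sum_{q\in\mathcal{U}_{p,0}}u(q)$ and, for $m\ge1$, $$H_mu(p)=\begin{cases}-(N-1)u(p)+\sum_{q\in\mathcal{U}_{p,m}}u(q), & p\in V_m\setminus V_{m-1},\\ H_{m-1}(u|_{V_{m-1}})(p)-(N-1)u(p)+\sum_{q\in\mathcal{U}_{p,m}}u(q), & p\in V_{m-1}.\end{cases}$$ For $m\ge1$, $\lambda_m\in\mathbb{R}$ is a Dirichlet eigenvalue of $H_m$ if there is $u_m\in\ell(V_m)$, $u_m\not\equiv0$, with $H_mu_m=-\lambda_mu_m$ on $V_m\setminus V_0$ and $u_m|_{V_0}=0$. The (geometric) multiplicity $M_m(\lambda_m)$ is the dimension of the real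 vector space of all $u\in\ell(V_m)$ with $u|_{V_0}=0$ and $H_mu=-\lambda_mu$ on $V_m\setminus V_0$.
   Formalization: That N is a Dirichlet eigenvalue is stated only for N > 2: for N = 2 the multiplicity N^m(N-2) is 0, so N is not an eigenvalue (e.g. for N = 2, m = 1 the only Dirichlet eigenvalue is 1). All other claims are stated for every N > 1. *)

theory Defs
  imports Complex_Main "HOL-Library.Function_Algebras"
begin

text \<open>
  Sequences are 0-indexed: the entry in position \<open>k \<ge> 1\<close> of a sequence \<open>p\<close> is \<open>p (k - 1)\<close>.
\<close>

definition shift_space :: "nat \<Rightarrow> (nat \<Rightarrow> nat) set" where
  "shift_space N = {p. \<forall>i. p i \<in> {1..N}}"

definition V :: "nat \<Rightarrow> nat \<Rightarrow> (nat \<Rightarrow> nat) set" where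
  "V N m = {p \<in> shift_space N. \<forall>i\<ge>m. p i = p m}"

text \<open>The sequence \<open>(p\<^sub>1 \<cdots> p\<^sub>m l l l \<cdots>)\<close>.\<close>

definition dotted :: "(nat \<Rightarrow> nat) \<Rightarrow> nat \<Rightarrow> nat \<Rightarrow> (nat \<Rightarrow> nat)" where
  "dotted p m l = (\<lambda>i. if i < m then p i else l)"

definition U :: "nat \<Rightarrow> (nat \<Rightarrow> nat) \<Rightarrow> nat \<Rightarrow> (nat \<Rightarrow> nat) set" where
  "U N p m = {dotted p m l | l. l \<in> {1..N}} - {p}"

text \<open>
  Real functions on a finite set \<open>A\<close> are represented by the total functions that vanish
  outside \<open>A\<close>, so that the pointwise operations make them a vector space of dimension
  \<open>card A\<close>; \<open>restr u A\<close> represents the restriction of \<open>u\<close> to \<open>A\<close>.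
\<close>

definition ell :: "'a set \<Rightarrow> ('a \<Rightarrow> real) set" where
  "ell A = {u. \<forall>p. p \<notin> A \<longrightarrow> u p = 0}"

definition restr :: "('a \<Rightarrow> real) \<Rightarrow> 'a set \<Rightarrow> ('a \<Rightarrow> real)" where
  "restr u A = (\<lambda>p. if p \<in> A then u p else 0)"

definition fun_scale :: "real \<Rightarrow> ('a \<Rightarrow> real) \<Rightarrow> ('a \<Rightarrow> real)" where
  "fun_scale c u = (\<lambda>p. c * u p)"

interpretation real_fun: vector_space fun_scale
  by unfold_locales (auto simp: fun_scale_def fun_eq_iff algebra_simps)

primrec H :: "nat \<Rightarrow> nat \<Rightarrow> ((nat \<Rightarrow> nat) \<Rightarrow> real) \<Rightarrow> ((nat \<Rightarrow> nat) \<Rightarrow> real)" where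
  "H N 0 u =
     (\<lambda>p. if p \<in> V N 0 then - (real N - 1) * u p + (\<Sum>q\<in>U N p 0. u q) else 0)"
| "H N (Suc m) u =
     (\<lambda>p. if p \<in> V N (Suc m) - V N m then
            - (real N - 1) * u p + (\<Sum>q\<in>U N p (Suc m). u q)
          else if p \<in> V N m then
            H N m (restr u (V N m)) p - (real N - 1) * u p + (\<Sum>q\<in>U N p (Suc m). u q)
          else 0)"

definition dirichlet_space :: "nat \<Rightarrow> nat \<Rightarrow> real \<Rightarrow> ((nat \<Rightarrow> nat) \<Rightarrow> real) set" where
  "dirichlet_space N m \<mu> =
     {u \<in> ell (V N m). (\<forall>p \<in> V N 0. u p = 0) \<and>
                       (\<forall>p \<in> V N m - V N 0. H N m u p = - \<mu> * u p)}"

definition dirichlet_eigenvalue :: "nat \<Rightarrow> nat \<Rightarrow> real \<Rightarrow> bool" where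
  "dirichlet_eigenvalue N m \<mu> \<longleftrightarrow> (\<exists>u \<in> dirichlet_space N m \<mu>. \<exists>p \<in> V N m. u p \<noteq> 0)"

definition dirichlet_multiplicity :: "nat \<Rightarrow> nat \<Rightarrow> real \<Rightarrow> nat" where
  "dirichlet_multiplicity N m \<mu> = real_fun.dim (dirichlet_space N m \<mu>)"

lemma H_linear: "H N m (\<lambda>q. a * u q + b * v q) p = a * H N m u p + b * H N m v p"
proof (induction m arbitrary: u v p)
  case 0
  show ?case by (simp add: algebra_simps sum.distrib sum_distrib_left)
next
  case (Suc m)
  have "restr (\<lambda>q. a * u q + b * v q) (V N m) =
      (\<lambda>q. a * restr u (V N m) q + b * restr v (V N m) q)"
    by (auto simp: restr_def)
  then have "H N m (restr (\<lambda>q. a * u q + b * v q) (V N m)) p =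
      a * H N m (restr u (V N m)) p + b * H N m (restr v (V N m)) p"
    by (simp add: Suc)
  then show ?case by (simp add: algebra_simps sum.distrib sum_distrib_left)
qed

lemma subspace_dirichlet_space: "real_fun.subspace (dirichlet_space N m \<mu>)"
proof -
  have "H N m (\<lambda>q. 0) p = 0" for p
    using H_linear[of N m 0 _ 0] by simp
  moreover have "H N m (\<lambda>q. u q + v q) p = H N m u p + H N m v p" for u v p
    using H_linear[of N m 1 u 1 v] by simp
  moreover have "H N m (\<lambda>q. c * u q) p = c * H N m u p" for c u p
    using H_linear[of N m c u 0] by simp
  ultimately show ?thesis
    by (auto simp: real_fun.subspace_def dirichlet_space_def ell_def fun_scale_def
        plus_fun_def zero_fun_def algebra_simps)
qed

end

theory Submission
  imports Defs
begin

text \<open>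
  Write \<open>S\<close> for the sum of \<open>u\<close> over a cell \<open>{(p\<^sub>1 \<cdots> p\<^sub>m l l \<cdots>) | l}\<close>. A cell of level \<open>m\<close> has a
  single point in \<open>V\<^bsub>m-1\<^esub>\<close>; at each of its other points the eigenvalue equation reads
  \<open>S = (N - \<lambda>) u\<close>, while a point of \<open>V\<^bsub>m-1\<^esub>\<close> gives
  \<open>H\<^bsub>m-1\<^esub> u + S = (N - \<lambda>) u\<close>. Summing the former over a cell yields
  \<open>(1 - \<lambda>) S = (N - \<lambda>) u\<close> at the point in \<open>V\<^bsub>m-1\<^esub>\<close>.
  For \<open>\<lambda> = 1\<close> this makes \<open>u\<close> vanish on \<open>V\<^bsub>m-1\<^esub>\<close>; then \<open>S = 0\<close> on all cells not meeting \<open>V\<^sub>0\<close>,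
  and \<open>u\<close> is a free constant off \<open>V\<^sub>0\<close> on each of the \<open>N\<close> cells that do.
  For \<open>\<lambda> = N\<close> all cell sums vanish, so the restriction of \<open>u\<close> to \<open>V\<^bsub>m-1\<^esub>\<close> is harmonic with zero
  boundary values, hence zero; each of the \<open>N\<^sup>m\<close> cells then carries \<open>N - 1\<close> values with sum zero.
\<close>

section \<open>Dimension of a function space from dual evaluation points\<close>

lemma sum_fun_apply: "(\<Sum>i\<in>I. f i) x = (\<Sum>i\<in>I. f i x)"
  by (induction I rule: infinite_finite_induct) auto

text \<open>Evaluation at the points of \<open>I\<close> is dual to the family \<open>b\<close>. It
  reads off coefficients, which gives independence; and \<open>u\<close> minus its interpolant
  vanishes on \<open>I\<close>, hence is zero, so \<open>b\<close> spans.\<close>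

lemma dim_eq_card_points:
  assumes W: "real_fun.subspace W" and "finite I"
    and b: "\<And>i. i \<in> I \<Longrightarrow> b i \<in> W"
    and dual: "\<And>i j. i \<in> I \<Longrightarrow> j \<in> I \<Longrightarrow> b i j = (if i = j then 1 else 0)"
    and determined: "\<And>u. u \<in> W \<Longrightarrow> (\<And>i. i \<in> I \<Longrightarrow> u i = 0) \<Longrightarrow> u = 0"
  shows "real_fun.dim W = card I"
proof -
  have inj: "inj_on b I"
  proof (rule inj_onI)
    fix i j assume "i \<in> I" "j \<in> I" "b i = b j"
    then show "i = j"
      using dual by (metis zero_neq_one)
  qed
  have eval: "(\<Sum>i\<in>I. fun_scale (c i) (b i)) j = c j" if "j \<in> I" for c j
  proof -
    have "(\<Sum>i\<in>I. fun_scale (c i) (b i)) j = (\<Sum>i\<in>I. if i = j then c i else 0)"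
      unfolding sum_fun_apply fun_scale_def using dual that by (intro sum.cong) auto
    then show ?thesis using that \<open>finite I\<close> by simp
  qed
  have "real_fun.independent (b ` I)"
  proof (rule real_fun.independent_if_scalars_zero)
    show "finite (b ` I)" using \<open>finite I\<close> by simp
    fix f x assume 0: "(\<Sum>x\<in>b ` I. fun_scale (f x) x) = 0" and "x \<in> b ` I"
    then obtain j where j: "j \<in> I" "x = b j" by auto
    have "(\<Sum>i\<in>I. fun_scale (f (b i)) (b i)) = 0"
      using 0 by (simp add: sum.reindex[OF inj])
    then show "f x = 0" using eval[OF j(1), of "\<lambda>i. f (b i)"] j(2) by simp
  qed
  moreover have "W \<subseteq> real_fun.span (b ` I)"
  proof
    fix u assume u: "u \<in> W"
    let ?v = "\<Sum>i\<in>I. fun_scale (u i) (b i)"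
    have "?v \<in> W"
      using W b by (intro real_fun.subspace_sum real_fun.subspace_scale) auto
    then have "u - ?v \<in> W" using W u real_fun.subspace_diff by blast
    then have "u - ?v = 0" by (rule determined) (simp add: eval)
    then have "u = ?v" by simp
    also have "\<dots> \<in> real_fun.span (b ` I)"
      by (intro real_fun.span_sum real_fun.span_scale real_fun.span_base) auto
    finally show "u \<in> real_fun.span (b ` I)" .
  qed
  ultimately show ?thesis
    using b card_image[OF inj] by (intro real_fun.dim_unique[of "b ` I"]) auto
qed

section \<open>Points of \<open>V N m\<close> and their extension by one letter\<close>

lemma V_entry: "p \<in> V N m \<Longrightarrow> p i \<in> {1..N}"
  unfolding V_def shift_space_def by blast

lemma V_const: "p \<in> V N m \<Longrightarrow> i \<ge> m \<Longrightarrow> p i = p m"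
  unfolding V_def by blast

lemma V_memI:
  assumes "\<And>i. p i \<in> {1..N}" "\<And>i. i \<ge> m \<Longrightarrow> p i = p m"
  shows "p \<in> V N m"
  using assms unfolding V_def shift_space_def by blast

lemma V_mono:
  assumes "k \<le> m"
  shows "V N k \<subseteq> V N m"
proof
  fix p assume p: "p \<in> V N k"
  show "p \<in> V N m"
  proof (rule V_memI)
    fix i assume "m \<le> i"
    then show "p i = p m" using V_const[OF p, of i] V_const[OF p, of m] assms by simp
  qed (rule V_entry[OF p])
qed

lemma dotted_entry [simp]:
  "k \<le> n \<Longrightarrow> dotted p (Suc n) l k = p k" "dotted p m l m = l"
  by (simp_all add: dotted_def)

lemma dotted_in_V:
  assumes "p \<in> V N m" "l \<in> {1..N}"
  shows "dotted p k l \<in> V N k"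
  using assms V_entry by (intro V_memI) (simp_all add: dotted_def)

lemma dotted_self:
  assumes "p \<in> V N m"
  shows "dotted p m (p m) = p"
  using V_const[OF assms, symmetric] by (simp add: dotted_def fun_eq_iff)

lemma V_Suc_iff:
  assumes p: "p \<in> V N (Suc n)"
  shows "p \<in> V N n \<longleftrightarrow> p (Suc n) = p n"
proof
  assume eq: "p (Suc n) = p n"
  show "p \<in> V N n"
  proof (rule V_memI)
    fix i assume "n \<le> i"
    then show "p i = p n" using V_const[OF p, of i] eq by (cases "i = n") auto
  qed (rule V_entry[OF p])
qed (use V_const[of p N n "Suc n"] in simp)

lemma V_0_iff:
  assumes p: "p \<in> V N n"
  shows "p \<in> V N 0 \<longleftrightarrow> (\<exists>l. \<forall>k\<le>n. p k = l)"
proof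
  assume "\<exists>l. \<forall>k\<le>n. p k = l"
  then have const: "\<forall>k\<le>n. p k = p 0" by (metis le0)
  show "p \<in> V N 0"
  proof (rule V_memI)
    fix i
    show "p i = p 0" using V_const[OF p] const by (metis nle_le)
  qed (rule V_entry[OF p])
qed (metis V_const le0)

lemma V_0_eq_const: "p \<in> V N 0 \<Longrightarrow> p = (\<lambda>_. p 0)"
  using V_const by blast

lemma dotted_in_V_iff:
  assumes "q \<in> V N n" "l \<in> {1..N}"
  shows "dotted q (Suc n) l \<in> V N n \<longleftrightarrow> l = q n"
  using V_Suc_iff[OF dotted_in_V[OF assms]] by (simp add: dotted_def)

text \<open>Letters are 0-indexed, so \<open>q\<close> already repeats \<open>q n\<close> from index
  \<open>n\<close> on: \<open>q n\<close> is the letter that singles out the old point of the cell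
  of level \<open>Suc n\<close> at \<open>q\<close>.\<close>

lemma dotted_special: "q \<in> V N n \<Longrightarrow> dotted q (Suc n) (q n) = q"
  using dotted_self[of q N "Suc n"] V_mono[of n "Suc n" N] V_Suc_iff[of q N n] by auto

lemma V_Suc_cases:
  assumes "p \<in> V N (Suc n)"
  obtains q where "q \<in> V N n" "p = dotted q (Suc n) (p (Suc n))" "p n = q n"
proof
  \<comment> \<open>The witness forgets the tail letter \<open>p (Suc n)\<close> and repeats
    \<open>p n\<close> instead; it is the old point of the cell of \<open>p\<close>.\<close>
  show "dotted p n (p n) \<in> V N n" using assms V_entry by (auto intro: dotted_in_V)
  show "p = dotted (dotted p n (p n)) (Suc n) (p (Suc n))"
    by (subst dotted_self[OF assms, symmetric]) (auto simp: dotted_def fun_eq_iff less_Suc_eq)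
  show "p n = dotted p n (p n) n" by (simp add: dotted_def)
qed

section \<open>Cell sums and the operators\<close>

definition cell_sum :: "nat \<Rightarrow> nat \<Rightarrow> (nat \<Rightarrow> nat) \<Rightarrow> ((nat \<Rightarrow> nat) \<Rightarrow> real) \<Rightarrow> real" where
  "cell_sum N m p u = (\<Sum>l\<in>{1..N}. u (dotted p m l))"

lemma dotted_dotted: "dotted (dotted p m l) m = dotted p m"
  by (auto simp: dotted_def fun_eq_iff)

lemma cell_sum_dotted [simp]: "cell_sum N m (dotted p m l) u = cell_sum N m p u"
  by (simp add: cell_sum_def dotted_dotted)

lemma sum_U:
  assumes "p \<in> V N m"
  shows "(\<Sum>q\<in>U N p m. u q) = cell_sum N m p u - u p"
proof -
  have inj: "inj_on (dotted p m) {1..N}"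
    by (rule inj_onI) (metis dotted_def less_irrefl)
  have "U N p m = dotted p m ` {1..N} - {p}" by (auto simp: U_def)
  moreover have "p \<in> dotted p m ` {1..N}"
    using dotted_self[OF assms] V_entry[OF assms] by (metis imageI)
  moreover have "sum u (dotted p m ` {1..N}) = cell_sum N m p u"
    by (simp only: sum.reindex[OF inj] cell_sum_def comp_def)
  ultimately show ?thesis by (simp add: sum_diff1 del: image_iff)
qed

lemma H_Suc_new:
  assumes "p \<in> V N (Suc n) - V N n"
  shows "H N (Suc n) u p = cell_sum N (Suc n) p u - real N * u p"
  using assms by (simp add: sum_U algebra_simps)

lemma H_Suc_old:
  assumes "p \<in> V N n"
  shows "H N (Suc n) u p = H N n (restr u (V N n)) p + cell_sum N (Suc n) p u - real N * u p"
  using assms V_mono[of n "Suc n" N] by (auto simp: sum_U subsetD algebra_simps)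

declare H.simps(2) [simp del]

lemma restr_eq_0: "(\<And>p. p \<in> A \<Longrightarrow> u p = 0) \<Longrightarrow> restr u A = (\<lambda>_. 0)"
  by (auto simp: restr_def)

lemma H_zero: "H N m (\<lambda>_. 0) p = 0"
  using H_linear[of N m 0 _ 0] by simp

lemma dirichlet_space_Suc_iff:
  "u \<in> dirichlet_space N (Suc n) \<mu> \<longleftrightarrow>
    u \<in> ell (V N (Suc n)) \<and> (\<forall>p\<in>V N 0. u p = 0) \<and>
    (\<forall>p\<in>V N (Suc n) - V N n. cell_sum N (Suc n) p u = (real N - \<mu>) * u p) \<and>
    (\<forall>p\<in>V N n - V N 0.
      H N n (restr u (V N n)) p + cell_sum N (Suc n) p u = (real N - \<mu>) * u p)"
proof -
  have "V N (Suc n) - V N 0 = (V N (Suc n) - V N n) \<union> (V N n - V N 0)"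
    using V_mono[of n "Suc n" N] V_mono[of 0 n N] by auto
  moreover have "H N (Suc n) u p = - \<mu> * u p \<longleftrightarrow> cell_sum N (Suc n) p u = (real N - \<mu>) * u p"
    if "p \<in> V N (Suc n) - V N n" for p
    using H_Suc_new[OF that, of u] by (auto simp: algebra_simps)
  moreover have "H N (Suc n) u p = - \<mu> * u p \<longleftrightarrow>
      H N n (restr u (V N n)) p + cell_sum N (Suc n) p u = (real N - \<mu>) * u p"
    if "p \<in> V N n - V N 0" for p
    using H_Suc_old[of p N n u] that by (auto simp: algebra_simps)
  ultimately show ?thesis unfolding dirichlet_space_def by (simp add: ball_Un)
qed

lemma cell_sum_split:
  assumes "q \<in> V N n"
  shows "cell_sum N (Suc n) q u = u q + (\<Sum>l\<in>{1..N} - {q n}. u (dotted q (Suc n) l))"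
  unfolding cell_sum_def
  using sum.remove[of "{1..N}" "q n" "\<lambda>l. u (dotted q (Suc n) l)"] V_entry[OF assms, of n]
  by (simp add: dotted_special[OF assms])

lemma new_cell_point:
  assumes "q \<in> V N n" "l \<in> {1..N} - {q n}"
  shows "dotted q (Suc n) l \<in> V N (Suc n) - V N n"
  using assms dotted_in_V_iff[of q N n l] dotted_in_V[of q N n l "Suc n"] by auto

text \<open>Here \<open>c\<close> stands for N - \<mu>, so the left factor is 1 - \<mu>. Multiplying
  the cell sum by \<open>c\<close> turns each of the N - 1 new terms into the cell sum
  itself.\<close>

lemma cell_sum_relation:
  assumes new: "\<And>p. p \<in> V N (Suc n) - V N n \<Longrightarrow> cell_sum N (Suc n) p u = c * u p"
    and q: "q \<in> V N n"
  shows "(c - real N + 1) * cell_sum N (Suc n) q u = c * u q"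
proof -
  let ?S = "cell_sum N (Suc n) q u"
  have "q n \<in> {1..N}" using V_entry[OF q] .
  then have card: "real (card ({1..N} - {q n})) = real N - 1" by (simp add: of_nat_diff)
  have "c * ?S = c * u q + (\<Sum>l\<in>{1..N} - {q n}. c * u (dotted q (Suc n) l))"
    by (subst cell_sum_split[OF q]) (simp only: distrib_left sum_distrib_left)
  also have "(\<Sum>l\<in>{1..N} - {q n}. c * u (dotted q (Suc n) l)) = (\<Sum>l\<in>{1..N} - {q n}. ?S)"
    using new[OF new_cell_point[OF q]] by (intro sum.cong) auto
  also have "\<dots> = (real N - 1) * ?S" using card by simp
  finally show ?thesis by (simp add: algebra_simps)
qed

section \<open>The eigenvalue equations for 0, 1 and N\<close>

lemma dirichlet_harmonic_zero:
  assumes "N > 0" "u \<in> dirichlet_space N m 0"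
  shows "u = 0"
  using assms(2)
proof (induction m arbitrary: u)
  case 0
  then show ?case by (auto simp: dirichlet_space_def ell_def fun_eq_iff)
next
  case (Suc n)
  let ?v = "restr u (V N n)"
  from Suc.prems have ell: "u \<in> ell (V N (Suc n))" and bd: "\<And>p. p \<in> V N 0 \<Longrightarrow> u p = 0"
    and new: "\<And>p. p \<in> V N (Suc n) - V N n \<Longrightarrow> cell_sum N (Suc n) p u = real N * u p"
    and old: "\<And>p. p \<in> V N n - V N 0 \<Longrightarrow> H N n ?v p + cell_sum N (Suc n) p u = real N * u p"
    by (auto simp: dirichlet_space_Suc_iff)
  \<comment> \<open>With \<open>c = N\<close> the left factor is 1. The cell sums thus cancel
    against \<open>N * u\<close> in the equations at old points, which leaves
    \<open>H N n ?v = 0\<close> off \<open>V N 0\<close>.\<close>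
  have S: "cell_sum N (Suc n) q u = real N * u q" if "q \<in> V N n" for q
    using cell_sum_relation[OF new that] by simp
  have "?v \<in> dirichlet_space N n 0"
    using bd old S V_mono[of 0 n N] by (auto simp: dirichlet_space_def ell_def restr_def)
  then have v: "?v = 0" by (rule Suc.IH)
  have u0: "u q = 0" if "q \<in> V N n" for q
    using fun_cong[OF v, of q] that by (simp add: restr_def)
  have "u p = 0" for p
  proof (cases "p \<in> V N (Suc n)")
    case True
    then obtain q where q: "q \<in> V N n" "p = dotted q (Suc n) (p (Suc n))" by (rule V_Suc_cases)
    have "cell_sum N (Suc n) p u = cell_sum N (Suc n) q u"
      by (subst q(2)) simp
    then show ?thesis using new[of p] S[OF q(1)] u0[OF q(1)] u0[of p] True \<open>N > 0\<close> by auto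
  qed (use ell in \<open>auto simp: ell_def\<close>)
  then show ?case by (simp add: fun_eq_iff)
qed

text \<open>With \<open>c = N - 1\<close> the left factor of \<open>cell_sum_relation\<close> is 0,
  so \<open>u\<close> vanishes on \<open>V N n\<close>. This removes the \<open>H N n\<close> term
  and decouples the cells.\<close>

lemma dirichlet_space_1_iff:
  assumes "N > 1"
  shows "u \<in> dirichlet_space N (Suc n) 1 \<longleftrightarrow>
    u \<in> ell (V N (Suc n)) \<and> (\<forall>p\<in>V N n. u p = 0) \<and>
    (\<forall>p\<in>V N (Suc n) - V N n. cell_sum N (Suc n) p u = (real N - 1) * u p) \<and>
    (\<forall>p\<in>V N n - V N 0. cell_sum N (Suc n) p u = 0)" (is "?L \<longleftrightarrow> ?R")
proof
  assume ?L
  then have new: "\<And>p. p \<in> V N (Suc n) - V N n \<Longrightarrow> cell_sum N (Suc n) p u = (real N - 1) * u p"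
    by (simp add: dirichlet_space_Suc_iff)
  have u0: "u q = 0" if "q \<in> V N n" for q
    using cell_sum_relation[OF new that] assms by simp
  then show ?R using \<open>?L\<close> by (auto simp: dirichlet_space_Suc_iff restr_eq_0 H_zero)
next
  assume ?R
  then show ?L using V_mono[of 0 n N]
    by (auto simp: dirichlet_space_Suc_iff restr_eq_0 H_zero)
qed

definition other :: "nat \<Rightarrow> nat" where
  "other a = (if a = 1 then 2 else 1)"

lemma other: "other a \<noteq> a" "N > 1 \<Longrightarrow> other a \<in> {1..N}"
  by (auto simp: other_def)

text \<open>The factor N - \<mu> is zero, so one new point per cell suffices to kill the cell sum;
  \<open>other\<close> supplies it. The restriction to \<open>V N n\<close> then satisfies the
  equations for eigenvalue 0.\<close>

lemma dirichlet_space_N_iff: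
  assumes "N > 1"
  shows "u \<in> dirichlet_space N (Suc n) (real N) \<longleftrightarrow>
    u \<in> ell (V N (Suc n)) \<and> (\<forall>p\<in>V N n. u p = 0) \<and> (\<forall>p\<in>V N n. cell_sum N (Suc n) p u = 0)"
    (is "?L \<longleftrightarrow> ?R")
proof
  assume L: ?L
  have S: "cell_sum N (Suc n) q u = 0" if "q \<in> V N n" for q
  proof -
    let ?p = "dotted q (Suc n) (other (q n))"
    have "?p \<in> V N (Suc n) - V N n"
      using new_cell_point[OF that] other(1) other(2)[OF assms] by blast
    then have "cell_sum N (Suc n) ?p u = (real N - real N) * u ?p"
      using L unfolding dirichlet_space_Suc_iff by blast
    then show ?thesis by simp
  qed
  have "restr u (V N n) \<in> dirichlet_space N n 0"
    using L S V_mono[of 0 n N]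
    by (auto simp: dirichlet_space_Suc_iff dirichlet_space_def[of N n] ell_def restr_def)
  then have v: "restr u (V N n) = 0" using assms by (intro dirichlet_harmonic_zero) simp_all
  have "u q = 0" if "q \<in> V N n" for q
    using fun_cong[OF v, of q] that by (simp add: restr_def)
  then show ?R using L S by (auto simp: dirichlet_space_Suc_iff)
next
  assume R: ?R
  have "cell_sum N (Suc n) p u = 0" if p: "p \<in> V N (Suc n)" for p
  proof -
    obtain q where q: "q \<in> V N n" "p = dotted q (Suc n) (p (Suc n))" using V_Suc_cases[OF p] .
    show ?thesis using R q(1) by (subst q(2)) simp
  qed
  then show ?L using R V_mono[of 0 n N]
    by (auto simp: dirichlet_space_Suc_iff restr_eq_0 H_zero)
qed

section \<open>Multiplicity of 1\<close>

lemma const_in_V: "l \<in> {1..N} \<Longrightarrow> (\<lambda>_. l) \<in> V N m"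
  by (rule V_memI) auto

text \<open>The basis function \<open>b i\<close> is the indicator of the new points in the cell of
  \<open>i\<close>, one for each cell meeting \<open>V N 0\<close>; \<open>?pt l\<close> is a chosen
  new point of that cell.\<close>

lemma multiplicity_1:
  assumes "N > 1"
  shows "dirichlet_multiplicity N (Suc n) 1 = N"
proof -
  let ?pt = "\<lambda>l. dotted (\<lambda>_. l) (Suc n) (other l)"
  let ?I = "?pt ` {1..N}"
  define b :: "(nat \<Rightarrow> nat) \<Rightarrow> (nat \<Rightarrow> nat) \<Rightarrow> real" where
    "b i p = (if p \<in> V N (Suc n) - V N n \<and> (\<forall>k\<le>n. p k = i k) then 1 else 0)" for i p
  have pt: "?pt l \<in> V N (Suc n) - V N n" if "l \<in> {1..N}" for l
    using new_cell_point[OF const_in_V, of l N "other l" n] other that assms by auto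
  have "real_fun.dim (dirichlet_space N (Suc n) 1) = card ?I"
  proof (rule dim_eq_card_points[where b = b])
    show "real_fun.subspace (dirichlet_space N (Suc n) 1)" by (rule subspace_dirichlet_space)
    show "finite ?I" by simp
  next
    fix i assume "i \<in> ?I"
    then obtain l where l: "l \<in> {1..N}" "i = ?pt l" by auto
    have il: "i k = l" if "k \<le> n" for k using that l(2) by (simp add: dotted_def)
    \<comment> \<open>The cell with prefix constantly \<open>l\<close> has N - 1 new points of value
      1 and an old point of value 0.\<close>
    have S: "cell_sum N (Suc n) q (b i) = (if \<forall>k\<le>n. q k = l then real N - 1 else 0)"
      if q: "q \<in> V N n" for q
    proof -
      have "b i (dotted q (Suc n) j) = (if \<forall>k\<le>n. q k = l then 1 else 0)"
        if "j \<in> {1..N} - {q n}" for j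
        using new_cell_point[OF q that] il by (auto simp: b_def)
      moreover have "real (card ({1..N} - {q n})) = real N - 1"
        using V_entry[OF q, of n] by (simp add: of_nat_diff)
      ultimately show ?thesis
        using q by (auto simp: cell_sum_split b_def[of i q])
    qed
    have "cell_sum N (Suc n) p (b i) = (real N - 1) * b i p" if p: "p \<in> V N (Suc n) - V N n" for p
    proof -
      obtain q where q: "q \<in> V N n" "p = dotted q (Suc n) (p (Suc n))"
        using V_Suc_cases[OF DiffD1[OF p]] .
      have "p k = q k" if "k \<le> n" for k using that by (subst q(2)) (simp add: dotted_def)
      moreover have "cell_sum N (Suc n) p (b i) = cell_sum N (Suc n) q (b i)"
        by (subst q(2)) simp
      ultimately show ?thesis using S[OF q(1)] p il by (auto simp: b_def)
    qed
    \<comment> \<open>A constant prefix of length \<open>Suc n\<close> would put \<open>p\<close>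
      into \<open>V N 0\<close>.\<close>
    moreover have "cell_sum N (Suc n) p (b i) = 0" if p: "p \<in> V N n - V N 0" for p
      using S[of p] p V_0_iff[of p N n] by auto
    ultimately show "b i \<in> dirichlet_space N (Suc n) 1"
      unfolding dirichlet_space_1_iff[OF assms] by (auto simp: ell_def b_def)
  next
    fix i j assume "i \<in> ?I" "j \<in> ?I"
    then obtain l l' where l: "l \<in> {1..N}" "i = ?pt l" and l': "l' \<in> {1..N}" "j = ?pt l'" by auto
    have "i = j \<longleftrightarrow> l = l'" using l(2) l'(2) by (metis dotted_def zero_less_Suc)
    moreover have "(\<forall>k\<le>n. j k = i k) \<longleftrightarrow> l' = l" using l(2) l'(2) by (auto simp: dotted_def)
    ultimately show "b i j = (if i = j then 1 else 0)" using pt[OF l'(1)] l'(2) by (auto simp: b_def)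
  next
    fix u assume u: "u \<in> dirichlet_space N (Suc n) 1" and z: "\<And>i. i \<in> ?I \<Longrightarrow> u i = 0"
    note u' = u[unfolded dirichlet_space_1_iff[OF assms]]
    have "u p = 0" if p: "p \<in> V N (Suc n) - V N n" for p
    proof -
      obtain q where q: "q \<in> V N n" "p = dotted q (Suc n) (p (Suc n))"
        using V_Suc_cases[OF DiffD1[OF p]] .
      have "cell_sum N (Suc n) q u = 0"
      \<comment> \<open>On a cell meeting \<open>V N 0\<close> the sum is a multiple of the value at
        the chosen point, which is zero; on the others it is zero by the equations at old
        points.\<close>
      proof (cases "q \<in> V N 0")
        case True
        then have "q = (\<lambda>_. q 0)" "q 0 \<in> {1..N}"
          using V_0_eq_const V_entry[OF q(1)] by auto
        then have "cell_sum N (Suc n) q u = cell_sum N (Suc n) (?pt (q 0)) u"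
          by (metis cell_sum_dotted)
        also have "\<dots> = (real N - 1) * u (?pt (q 0))"
          using u' pt[OF \<open>q 0 \<in> {1..N}\<close>] by blast
        finally show ?thesis using z \<open>q 0 \<in> {1..N}\<close> by simp
      qed (use u' q(1) in auto)
      then have "cell_sum N (Suc n) p u = 0" by (subst q(2)) simp
      then show ?thesis using u' p assms by auto
    qed
    then show "u = 0" using u' by (auto simp: ell_def fun_eq_iff)
  qed
  moreover have "inj_on ?pt {1..N}"
    by (rule inj_onI) (metis dotted_def zero_less_Suc)
  ultimately show ?thesis by (simp add: dirichlet_multiplicity_def card_image)
qed

section \<open>Counting points and the multiplicity of N\<close>

lemma V_0_eq: "V N 0 = (\<lambda>l _. l) ` {1..N}"
proof -
  have "p \<in> (\<lambda>l _. l) ` {1..N}" if "p \<in> V N 0" for p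
    using V_0_eq_const[OF that] V_entry[OF that, of 0] by (metis imageI)
  then show ?thesis using const_in_V by auto
qed

text \<open>A point of \<open>V N n\<close> is determined by its letters up to index
  \<open>n\<close>, which the extension keeps. Allowing all of \<open>UNIV\<close> for the letter
  serves both the count of \<open>V\<close> and that of the basis points.\<close>

lemma inj_on_dotted_pair:
  "inj_on (\<lambda>(q, l). dotted q (Suc n) l) (V N n \<times> UNIV)"
proof (clarsimp simp: inj_on_def)
  fix q l q' l' assume q: "q \<in> V N n" and q': "q' \<in> V N n"
    and eq: "dotted q (Suc n) l = dotted q' (Suc n) l'"
  have le: "q k = q' k" if "k \<le> n" for k
    using fun_cong[OF eq, of k] that by simp
  have "q k = q' k" for k
    using le V_const[OF q] V_const[OF q'] by (metis nle_le)
  moreover have "l = l'" using fun_cong[OF eq, of "Suc n"] by simp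
  ultimately show "q = q' \<and> l = l'" by blast
qed

lemma V_Suc_eq: "V N (Suc n) = (\<lambda>(q, l). dotted q (Suc n) l) ` (V N n \<times> {1..N})"
proof -
  have "p \<in> (\<lambda>(q, l). dotted q (Suc n) l) ` (V N n \<times> {1..N})" if p: "p \<in> V N (Suc n)" for p
    using V_Suc_cases[OF p] V_entry[OF p, of "Suc n"] by (metis (no_types, lifting) SigmaI case_prod_conv imageI)
  then show ?thesis using dotted_in_V by auto
qed

lemma card_V: "finite (V N n) \<and> card (V N n) = N ^ Suc n"
proof (induction n)
  case 0
  have "inj_on (\<lambda>l (_::nat). l) {1..N}" by (rule inj_onI) meson
  then show ?case by (simp add: V_0_eq card_image del: One_nat_def)
next
  case (Suc n)
  then show ?case
    unfolding V_Suc_eq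
    by (subst card_image[OF inj_on_subset[OF inj_on_dotted_pair]]) (auto simp: card_cartesian_product)
qed

text \<open>Each cell has N - 2 free values: the old point carries 0, and the value at the
  \<open>other\<close> letter is forced by the zero sum. Accordingly \<open>b i\<close> is 1 at
  \<open>i\<close>, -1 at the \<open>other\<close> point of its cell, and 0 elsewhere.\<close>

lemma multiplicity_N:
  assumes "N > 1"
  shows "dirichlet_multiplicity N (Suc n) (real N) = N ^ Suc n * (N - 2)"
proof -
  let ?D = "SIGMA q:V N n. {1..N} - {q n, other (q n)}"
  let ?I = "(\<lambda>(q, l). dotted q (Suc n) l) ` ?D"
  define f :: "(nat \<Rightarrow> nat) \<Rightarrow> nat \<Rightarrow> real" where
    "f i l = (if l = i (Suc n) then 1 else if l = other (i n) then - 1 else 0)" for i l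
  define b :: "(nat \<Rightarrow> nat) \<Rightarrow> (nat \<Rightarrow> nat) \<Rightarrow> real" where
    "b i p = (if p \<in> V N (Suc n) \<and> (\<forall>k\<le>n. p k = i k) then f i (p (Suc n)) else 0)" for i p
  have fin: "finite ?D" using card_V by auto
  have I: "i \<in> V N (Suc n)" "i (Suc n) \<noteq> i n" "i (Suc n) \<noteq> other (i n)" if "i \<in> ?I" for i
    using that dotted_in_V by auto
  have "real_fun.dim (dirichlet_space N (Suc n) (real N)) = card ?I"
  proof (rule dim_eq_card_points[where b = b])
    show "real_fun.subspace (dirichlet_space N (Suc n) (real N))"
      by (rule subspace_dirichlet_space)
    show "finite ?I" using fin by blast
  next
    fix i assume i: "i \<in> ?I"
    \<comment> \<open>An old point with the prefix of \<open>i\<close> has last letter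
      \<open>i n\<close>, which is neither of the two letters where \<open>f i\<close> is
      nonzero.\<close>
    have "b i p = 0" if p: "p \<in> V N n" for p
      using I[OF i] V_Suc_iff[of p N n] p other(1)[of "i n"] by (auto simp: b_def f_def)
    moreover have "cell_sum N (Suc n) q (b i) = 0" if q: "q \<in> V N n" for q
    proof -
      have "(\<Sum>l\<in>{1..N}. f i l) =
          (\<Sum>l\<in>{1..N}. (if l = i (Suc n) then 1 else 0) - (if l = other (i n) then 1 else 0))"
        using I(3)[OF i] by (intro sum.cong) (auto simp: f_def)
      also have "\<dots> = 0"
        using V_entry[OF I(1)[OF i], of "Suc n"] other(2)[OF assms, of "i n"]
        by (simp add: sum_subtractf)
      finally have "(\<Sum>l\<in>{1..N}. f i l) = 0" .
      moreover have "b i (dotted q (Suc n) l) = (if \<forall>k\<le>n. q k = i k then f i l else 0)"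
        if "l \<in> {1..N}" for l
        using dotted_in_V[OF q that, of "Suc n"] by (auto simp: b_def)
      ultimately show ?thesis by (cases "\<forall>k\<le>n. q k = i k") (simp_all add: cell_sum_def)
    qed
    ultimately show "b i \<in> dirichlet_space N (Suc n) (real N)"
      unfolding dirichlet_space_N_iff[OF assms] by (simp add: ell_def) (simp add: b_def)
  next
    fix i j assume i: "i \<in> ?I" and j: "j \<in> ?I"
    have "i = j" if "\<forall>k\<le>n. j k = i k" "j (Suc n) = i (Suc n)"
    proof -
      have "dotted i (Suc n) (i (Suc n)) = dotted j (Suc n) (j (Suc n))"
        using that by (auto simp: dotted_def fun_eq_iff)
      then show ?thesis using dotted_self I(1)[OF i] I(1)[OF j] by metis
    qed
    then show "b i j = (if i = j then 1 else 0)"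
      using I[OF j] by (auto simp: b_def f_def)
  next
    fix u assume u: "u \<in> dirichlet_space N (Suc n) (real N)" and z: "\<And>i. i \<in> ?I \<Longrightarrow> u i = 0"
    note u' = u[unfolded dirichlet_space_N_iff[OF assms]]
    have "u p = 0" if p: "p \<in> V N (Suc n)" for p
    proof -
      obtain q where q: "q \<in> V N n" "p = dotted q (Suc n) (p (Suc n))"
        using V_Suc_cases[OF p] .
      have rest: "u (dotted q (Suc n) l) = 0" if l: "l \<in> {1..N} - {other (q n)}" for l
      proof (cases "l = q n")
        case True
        then show ?thesis using u' q(1) by (simp add: dotted_special)
      next
        case False
        then have "(q, l) \<in> ?D" using l q(1) by auto
        then show ?thesis using z by force
      qed
      \<comment> \<open>All remaining terms of the cell vanish, so the zero sum forces the last
        value to be zero.\<close>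
      have "cell_sum N (Suc n) q u = u (dotted q (Suc n) (other (q n)))"
        unfolding cell_sum_def
        using sum.remove[of "{1..N}" "other (q n)" "\<lambda>l. u (dotted q (Suc n) l)"]
          other(2)[OF assms] rest by simp
      then have "u (dotted q (Suc n) l) = 0" if "l \<in> {1..N}" for l
        using u' q(1) rest[of l] that by (cases "l = other (q n)") auto
      then show ?thesis using V_entry[OF p] q(2) by metis
    qed
    then show "u = 0" using u' by (auto simp: ell_def fun_eq_iff)
  qed
  also have "\<dots> = card ?D"
    by (intro card_image inj_on_subset[OF inj_on_dotted_pair]) auto
  also have "\<dots> = (\<Sum>q\<in>V N n. card ({1..N} - {q n, other (q n)}))"
    using card_V by (intro card_SigmaI) auto
  also have "\<dots> = (\<Sum>q\<in>V N n. N - 2)"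
  proof (rule sum.cong)
    fix q assume "q \<in> V N n"
    then have "{q n, other (q n)} \<subseteq> {1..N}"
      using V_entry[of q N n n] other(2)[OF assms, of "q n"] by simp
    then show "card ({1..N} - {q n, other (q n)}) = N - 2"
      using other(1)[of "q n"] by (subst card_Diff_subset) auto
  qed simp
  finally show ?thesis using card_V[of N n] by (simp add: dirichlet_multiplicity_def)
qed

section \<open>From multiplicities to eigenvalues\<close>

lemma dirichlet_eigenvalue_if_multiplicity_pos:
  assumes "dirichlet_multiplicity N m \<mu> > 0"
  shows "dirichlet_eigenvalue N m \<mu>"
proof (rule ccontr)
  assume "\<not> ?thesis"
  \<comment> \<open>Members of \<open>ell\<close> vanish off \<open>V N m\<close>, so being zero on
    \<open>V N m\<close> means being the zero vector.\<close>
  then have "u p = 0" if "u \<in> dirichlet_space N m \<mu>" for u p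
    using that unfolding dirichlet_eigenvalue_def
    by (cases "p \<in> V N m") (auto simp: dirichlet_space_def ell_def)
  then have "dirichlet_space N m \<mu> \<subseteq> {0}" by (auto simp: fun_eq_iff)
  then have "real_fun.dim (dirichlet_space N m \<mu>) \<le> card ({} :: ((nat \<Rightarrow> nat) \<Rightarrow> real) set)"
    by (intro real_fun.dim_le_card) simp_all
  then show False using assms by (simp add: dirichlet_multiplicity_def)
qed

theorem proposition6p1:
  fixes N m :: nat
  assumes "N > 1" and "m \<ge> 1"
  shows "dirichlet_eigenvalue N m 1 \<and>
         (N > 2 \<longrightarrow> dirichlet_eigenvalue N m (real N)) \<and>
         dirichlet_multiplicity N m 1 = N \<and>
         dirichlet_multiplicity N m (real N) = N ^ m * (N - 2)"
proof -
  obtain n where "m = Suc n" using assms(2) by (cases m) auto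
  then have "dirichlet_multiplicity N m 1 = N"
    "dirichlet_multiplicity N m (real N) = N ^ m * (N - 2)"
    using multiplicity_1 multiplicity_N assms(1) by auto
  \<comment> \<open>Positivity of \<open>N ^ m * (N - 2)\<close> is where \<open>N > 2\<close>
    enters; for \<open>N = 2\<close> this multiplicity is 0.\<close>
  then show ?thesis using assms(1) by (auto intro!: dirichlet_eigenvalue_if_multiplicity_pos)
qed

end
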